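(* Let $P\in\mathbb{Z}_{\ge 1}$, let $G$ be the transfer function of a causal discrete-time LTI system, let $H=H_{\overline g^P}$ be the associated $P\times P$ circulant matrix with first column $\overline g^P$, and let $\psi:\mathbb{R}\to\mathbb{R}$ be a memoryless feedback function with bounded range, $\mathcal{B}(\psi):=\sup_{x\in\mathbb{R}}|\psi(x)|<\infty$. If $u^P\in\mathbb{R}^P\setminus\{0\}$ is a nontrivial $P$-periodic fixed-point, i.e. $u^P=-H\,\psi(u^P)$, then its amplitude $\|u^P\|_\infty$ satisfies $$\|u^P\|_\infty\le\|\overline g^P\|_1\,\mathcal{B}(\psi),$$ and also the (coarser) bound $$\|u^P\|_\infty\le P^{1/2}\,\sigma_1(H)\,\mathcal{B}(\psi).$$
   Context: System: a scalar, finite-dimensional, causal discrete-time linear time-invariant system (stable or unstable) with real impulse response $g\not\equiv0$ and proper rational transfer function $G(z)=\sum_{t\ge 0}g(t)z^{-t}$ with real coefficients, evaluated as a rational function and assumed to have no pole at a $P$-th root of unity. Memoryless means that $\psi:\mathbb{R}\to\mathbb{R}$ is a function of the current value only (no continuity assumed); $\psi(v)$ for $v\in\mathbb{R}^P$ is applied entrywise. Circulant matrix: let $F_P=\big(e^{-2\pi j kl/P}\big)_{k,l=0}^{P-1}$ be the DFT matrix ($j$ is the imaginary unit), $\Lambda_G^P=\operatorname{diag}\big(G(1),G(e^{-2\pi j/P}),\dots,G(e^{-2(P-1)\pi j/P})\big)$, and $\overline g^P=F_P^{-1}\Lambda_G^P\mathbf{1}_P\in\mathbb{R}^P$, where $\mathbf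 1_P$ is the all-ones vector. Then $H_{\overline g^P}:=F_P^{-1}\Lambda_G^P F_P$, which is the circulant matrix with first column $\overline g^P$. $\sigma_1(H)$ denotes the largest singular value of $H$. A nontrivial $P$-periodic fixed-point is a nonzero $P$-periodic real sequence $u$, identified with its one-period vector $u^P=(u(0),\dots,u(P-1))^\top$, satisfying $u^P=-H_{\overline g^P}\psi(u^P)$. *)

theory Defs
  imports
    Complex_Main
    "HOL-Computational_Algebra.Polynomial"
    "Jordan_Normal_Form.Gauss_Jordan_Elimination"
    "Jordan_Normal_Form.Char_Poly"
    "Jordan_Normal_Form.Schur_Decomposition"
begin

definition rational_eval :: "real poly \<Rightarrow> real poly \<Rightarrow> complex \<Rightarrow> complex" where
  "rational_eval num den z =
     poly (map_poly complex_of_real num) z / poly (map_poly complex_of_real den) z"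

(* Causality is the indexing of the impulse response g by nat. The z-transform of g is only
   required to converge outside some disc, so unstable systems are included; num / den is in
   lowest terms, so that the poles of the transfer function are exactly the zeros of den. *)
definition lti_system :: "(nat \<Rightarrow> real) \<Rightarrow> real poly \<Rightarrow> real poly \<Rightarrow> bool" where
  "lti_system g num den \<longleftrightarrow>
     (\<exists>t. g t \<noteq> 0) \<and>
     den \<noteq> 0 \<and> coprime num den \<and> degree num \<le> degree den \<and>
     (\<forall>\<^sub>F z in at_infinity. (\<lambda>t. complex_of_real (g t) / z ^ t) sums rational_eval num den z)"

definition no_pole_at_roots_of_unity :: "real poly \<Rightarrow> nat \<Rightarrow> bool" where
  "no_pole_at_roots_of_unity den P \<longleftrightarrow>
     (\<forall>z. z ^ P = 1 \<longrightarrow> poly (map_poly complex_of_real den) z \<noteq> 0)"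

definition dft_mat :: "nat \<Rightarrow> complex mat" where
  "dft_mat P = mat P P (\<lambda>(k, l). exp (- (2 * of_real pi * \<i> * of_nat k * of_nat l / of_nat P)))"

definition transfer_diag :: "real poly \<Rightarrow> real poly \<Rightarrow> nat \<Rightarrow> complex mat" where
  "transfer_diag num den P =
     mat_diag P (\<lambda>k. rational_eval num den (exp (- (2 * of_real pi * \<i> * of_nat k / of_nat P))))"

(* The entries of g_bar and H_circ are real in the intended use, but both are kept as complex
   objects, so that no projection to the reals has to be inserted. The matrix dft_mat P is
   invertible, hence mat_inverse returns Some. *)
definition g_bar :: "real poly \<Rightarrow> real poly \<Rightarrow> nat \<Rightarrow> complex vec" where
  "g_bar num den P =
     the (mat_inverse (dft_mat P)) *\<^sub>v (transfer_diag num den P *\<^sub>v vec P (\<lambda>_. 1))"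

definition H_circ :: "real poly \<Rightarrow> real poly \<Rightarrow> nat \<Rightarrow> complex mat" where
  "H_circ num den P = the (mat_inverse (dft_mat P)) * transfer_diag num den P * dft_mat P"

definition singular_values :: "complex mat \<Rightarrow> real set" where
  "singular_values A = {s. 0 \<le> s \<and> eigenvalue (mat_adjoint A * A) (complex_of_real (s\<^sup>2))}"

definition sigma1 :: "complex mat \<Rightarrow> real" where
  "sigma1 A = Max (singular_values A)"

definition norm1_vec :: "'a::real_normed_vector vec \<Rightarrow> real" where
  "norm1_vec v = (\<Sum>i<dim_vec v. norm (v $ i))"

definition norm_inf_vec :: "'a::real_normed_vector vec \<Rightarrow> real" where
  "norm_inf_vec v = Max ((\<lambda>i. norm (v $ i)) ` {..<dim_vec v})"

definition nontrivial_fixed_point ::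
    "real poly \<Rightarrow> real poly \<Rightarrow> nat \<Rightarrow> (real \<Rightarrow> real) \<Rightarrow> real vec \<Rightarrow> bool" where
  "nontrivial_fixed_point num den P \<psi> u \<longleftrightarrow>
     u \<in> carrier_vec P \<and> u \<noteq> 0\<^sub>v P \<and>
     map_vec complex_of_real u =
       - (H_circ num den P *\<^sub>v map_vec complex_of_real (map_vec \<psi> u))"

end

theory Submission
  imports Defs "HOL-Analysis.Convex" "Jordan_Normal_Form.Spectral_Radius"
begin

text \<open>
  Each row of the circulant matrix \<open>H\<close> is a permutation of its first column \<open>g\<close>, so every entry of
  \<open>H \<psi>(u)\<close> is at most \<open>\<parallel>g\<parallel>\<^sub>1 B(\<psi>)\<close>. By Cauchy--Schwarz \<open>\<parallel>g\<parallel>\<^sub>1 \<le> \<surd>P \<parallel>g\<parallel>\<^sub>2\<close>, and \<open>\<parallel>g\<parallel>\<^sub>2\<^sup>2\<close> is the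
  \<open>(0,0)\<close> entry of \<open>H\<^sup>* H\<close>. As \<open>H\<^sup>* H = F\<^sup>-\<^sup>1 |\<Lambda>|\<^sup>2 F\<close>, this entry is the mean of the numbers \<open>|\<Lambda>\<^sub>k|\<^sup>2\<close>,
  which are eigenvalues of \<open>H\<^sup>* H\<close>, so it is at most \<open>\<sigma>\<^sub>1(H)\<^sup>2\<close>.
\<close>

section \<open>The DFT matrix, its inverse, and circulants given by a spectrum\<close>

definition idft_mat :: "nat \<Rightarrow> complex mat" where
  "idft_mat P = mat P P (\<lambda>(k, l). cis (2 * pi * real k * real l / real P) / of_nat P)"

text \<open>Entrywise form of the inverse DFT matrix times \<open>mat_diag P f\<close> times the DFT
  matrix. An arbitrary spectrum \<open>f\<close> is allowed, so that products, adjoints and Gram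
  matrices stay in the same family.\<close>

definition circ_of_spectrum :: "nat \<Rightarrow> (nat \<Rightarrow> complex) \<Rightarrow> complex mat" where
  "circ_of_spectrum P f = mat P P
     (\<lambda>(i, j). (\<Sum>k<P. f k * cis (2 * pi * real k * (real i - real j) / real P)) / of_nat P)"

lemma dft_mat_carrier [simp]: "dft_mat P \<in> carrier_mat P P"
  and idft_mat_carrier [simp]: "idft_mat P \<in> carrier_mat P P"
  and circ_of_spectrum_carrier [simp]: "circ_of_spectrum P f \<in> carrier_mat P P"
  by (simp_all add: dft_mat_def idft_mat_def circ_of_spectrum_def)

lemma dft_mat_dim [simp]: "dim_row (dft_mat P) = P" "dim_col (dft_mat P) = P"
  and idft_mat_dim [simp]: "dim_row (idft_mat P) = P" "dim_col (idft_mat P) = P"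
  and circ_of_spectrum_dim [simp]:
    "dim_row (circ_of_spectrum P f) = P" "dim_col (circ_of_spectrum P f) = P"
  by (simp_all add: dft_mat_def idft_mat_def circ_of_spectrum_def)

lemma dft_mat_index:
  assumes "k < P" "l < P"
  shows "dft_mat P $$ (k, l) = cis (- (2 * pi * real k * real l / real P))"
  using assms by (simp add: dft_mat_def cis_conv_exp mult_ac)

lemma idft_mat_index:
  assumes "k < P" "l < P"
  shows "idft_mat P $$ (k, l) = cis (2 * pi * real k * real l / real P) / of_nat P"
  using assms by (simp add: idft_mat_def)

text \<open>Off the diagonal this is a full geometric sum whose ratio is a \<open>P\<close>-th root
  of unity other than 1, so it vanishes.\<close>

lemma sum_cis_orthogonality:
  assumes "k < P" "l < P"
  shows "(\<Sum>m<P. cis (2 * pi * real m * (real l - real k) / real P)) = (if k = l then of_nat P else 0)"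
proof (cases "k = l")
  case False
  define x where "x = cis (2 * pi * (real l - real k) / real P)"
  have pow: "x ^ m = cis (2 * pi * real m * (real l - real k) / real P)" for m
    by (simp add: x_def DeMoivre mult_ac)
  have "x ^ P = cis (2 * pi * of_int (int l - int k))"
    unfolding pow using assms by (simp add: mult_ac)
  also have "\<dots> = 1"
    by (rule cis_multiple_2pi) (rule Ints_of_int)
  finally have xP: "x ^ P = 1" .
  have "x \<noteq> 1"
  proof
    assume "x = 1"
    \<comment> \<open>A trivial ratio would identify the roots of unity with indices
      \<open>k\<close> and \<open>l\<close>, but distinct indices below \<open>P\<close> give
      distinct roots.\<close>
    have "cis (2 * pi * real l / real P) = x * cis (2 * pi * real k / real P)"
      by (simp add: x_def cis_mult algebra_simps add_divide_distrib diff_divide_distrib)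
    also have "\<dots> = cis (2 * pi * real k / real P)"
      by (simp add: \<open>x = 1\<close>)
    finally have "l = k"
      using bij_betw_roots_unity[of P] assms by (auto simp: bij_betw_def inj_on_def)
    with False show False by simp
  qed
  then show ?thesis
    using False geometric_sum[of x P] by (simp add: xP flip: pow)
qed simp

lemma dft_idft: "dft_mat P * idft_mat P = 1\<^sub>m P"
proof (rule eq_matI)
  fix k l assume "k < dim_row (1\<^sub>m P)" "l < dim_col (1\<^sub>m P)"
  then have kl: "k < P" "l < P" by auto
  have "(dft_mat P * idft_mat P) $$ (k, l) =
      (\<Sum>m<P. cis (- (2 * pi * real k * real m / real P)) * (cis (2 * pi * real m * real l / real P) / of_nat P))"
    using kl by (simp add: scalar_prod_def dft_mat_index idft_mat_index atLeast0LessThan)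
  also have "\<dots> = (\<Sum>m<P. cis (2 * pi * real m * (real l - real k) / real P)) / of_nat P"
    by (simp add: sum_divide_distrib cis_mult field_simps)
  also have "\<dots> = 1\<^sub>m P $$ (k, l)"
    using kl by (simp add: sum_cis_orthogonality)
  finally show "(dft_mat P * idft_mat P) $$ (k, l) = 1\<^sub>m P $$ (k, l)" .
qed simp_all

lemma idft_dft: "idft_mat P * dft_mat P = 1\<^sub>m P"
  by (rule mat_mult_left_right_inverse[OF _ _ dft_idft]) simp_all

text \<open>\<open>None\<close> would contradict that \<open>idft_mat P\<close> is a two-sided
  inverse; in the case \<open>Some B\<close>, the left inverse \<open>B\<close> equals the right
  inverse \<open>idft_mat P\<close>.\<close>

lemma mat_inverse_dft: "mat_inverse (dft_mat P) = Some (idft_mat P)"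
proof (cases "mat_inverse (dft_mat P)")
  case None
  from mat_inverse(1)[OF _ this, of P "()"] have "dft_mat P \<notin> Units (ring_mat TYPE(complex) P ())"
    by simp
  moreover have "dft_mat P \<in> Units (ring_mat TYPE(complex) P ())"
    unfolding Units_def ring_mat_def using dft_idft[of P] idft_dft[of P] idft_mat_carrier[of P] by auto
  ultimately show ?thesis by simp
next
  case (Some B)
  from mat_inverse(2)[OF _ Some, of P]
  have B: "B * dft_mat P = 1\<^sub>m P" "B \<in> carrier_mat P P" by auto
  have "B = B * (dft_mat P * idft_mat P)"
    using B by (simp add: dft_idft)
  also have "\<dots> = (B * dft_mat P) * idft_mat P"
    by (rule assoc_mult_mat[symmetric]) (use B in auto)
  also have "\<dots> = idft_mat P"
    by (simp add: B)
  finally show ?thesis using Some by simp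
qed

section \<open>Algebra and eigenvalues of circulant matrices\<close>

lemma circ_of_spectrum_conv: "idft_mat P * mat_diag P f * dft_mat P = circ_of_spectrum P f"
proof (rule eq_matI)
  fix i j assume "i < dim_row (circ_of_spectrum P f)" "j < dim_col (circ_of_spectrum P f)"
  then have ij: "i < P" "j < P" by auto
  have "(idft_mat P * mat_diag P f * dft_mat P) $$ (i, j) =
      (\<Sum>k<P. cis (2 * pi * real i * real k / real P) / of_nat P * f k * cis (- (2 * pi * real k * real j / real P)))"
    using ij by (subst mat_diag_mult_right[of _ P P])
      (simp_all add: scalar_prod_def dft_mat_index idft_mat_index atLeast0LessThan)
  also have "\<dots> = (\<Sum>k<P. f k * cis (2 * pi * real k * (real i - real j) / real P) / of_nat P)"
  proof (rule sum.cong[OF refl])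
    fix k
    have "cis (2 * pi * real k * (real i - real j) / real P) =
        cis (2 * pi * real i * real k / real P) * cis (- (2 * pi * real k * real j / real P))"
      by (simp add: cis_mult algebra_simps diff_divide_distrib)
    then show "cis (2 * pi * real i * real k / real P) / of_nat P * f k * cis (- (2 * pi * real k * real j / real P)) =
        f k * cis (2 * pi * real k * (real i - real j) / real P) / of_nat P"
      by simp
  qed
  also have "\<dots> = circ_of_spectrum P f $$ (i, j)"
    using ij by (simp add: circ_of_spectrum_def sum_divide_distrib)
  finally show "(idft_mat P * mat_diag P f * dft_mat P) $$ (i, j) = circ_of_spectrum P f $$ (i, j)" .
qed simp_all

text \<open>Both factors are diagonalised by the same Fourier matrix; the inner
  \<open>?F * ?B\<close> cancels and the diagonals multiply.\<close>

lemma circ_of_spectrum_mult: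
  "circ_of_spectrum P f * circ_of_spectrum P h = circ_of_spectrum P (\<lambda>k. f k * h k)"
proof -
  let ?F = "dft_mat P" and ?B = "idft_mat P"
  have "circ_of_spectrum P f * circ_of_spectrum P h =
      ?B * mat_diag P f * (?F * (?B * mat_diag P h * ?F))"
    unfolding circ_of_spectrum_conv[symmetric] by (rule assoc_mult_mat[of _ P P _ P _ P]) (auto intro!: mult_carrier_mat[of _ P P _ P])
  also have "?F * (?B * mat_diag P h * ?F) = ?F * (?B * (mat_diag P h * ?F))"
    by (subst assoc_mult_mat[of _ P P _ P _ P]) (auto intro!: mult_carrier_mat[of _ P P _ P])
  also have "\<dots> = ?F * ?B * (mat_diag P h * ?F)"
    by (rule assoc_mult_mat[of _ P P _ P _ P, symmetric]) (auto intro!: mult_carrier_mat[of _ P P _ P])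
  also have "\<dots> = mat_diag P h * ?F"
    by (simp add: dft_idft mat_diag_mult_left[of _ P P])
  also have "?B * mat_diag P f * (mat_diag P h * ?F) = ?B * mat_diag P f * mat_diag P h * ?F"
    by (rule assoc_mult_mat[of _ P P _ P _ P, symmetric]) (auto intro!: mult_carrier_mat[of _ P P _ P])
  also have "?B * mat_diag P f * mat_diag P h = ?B * (mat_diag P f * mat_diag P h)"
    by (rule assoc_mult_mat[of _ P P _ P _ P]) (auto intro!: mult_carrier_mat[of _ P P _ P])
  finally show ?thesis
    by (simp add: circ_of_spectrum_conv)
qed

lemma mat_adjoint_index:
  assumes "i < dim_col A" "j < dim_row A"
  shows "mat_adjoint A $$ (i, j) = conjugate (A $$ (j, i))"
  using assms by (simp add: mat_adjoint_def mat_of_rows_def)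

lemma mat_adjoint_dim [simp]:
  "dim_row (mat_adjoint A) = dim_col A" "dim_col (mat_adjoint A) = dim_row A"
  by (simp_all add: mat_adjoint_def mat_of_rows_def)

lemma circ_of_spectrum_adjoint:
  "mat_adjoint (circ_of_spectrum P f) = circ_of_spectrum P (\<lambda>k. cnj (f k))"
  by (rule eq_matI)
    (simp_all add: mat_adjoint_index, simp add: circ_of_spectrum_def cis_cnj algebra_simps diff_divide_distrib)

lemma circ_of_spectrum_gram:
  "mat_adjoint (circ_of_spectrum P f) * circ_of_spectrum P f =
    circ_of_spectrum P (\<lambda>k. of_real ((cmod (f k))\<^sup>2))"
  by (simp add: circ_of_spectrum_adjoint circ_of_spectrum_mult complex_norm_square mult.commute del: of_real_power)

text \<open>The eigenvector is column \<open>k\<close> of the inverse DFT matrix: \<open>?F\<close>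
  sends it to the \<open>k\<close>-th unit vector, which the diagonal factor scales by
  \<open>f k\<close>.\<close>

lemma circ_of_spectrum_eigenvalue:
  assumes "k < P"
  shows "eigenvalue (circ_of_spectrum P f) (f k)"
proof -
  let ?F = "dft_mat P" and ?B = "idft_mat P"
  define v where "v = ?B *\<^sub>v unit_vec P k"
  have v: "v \<in> carrier_vec P" unfolding v_def by (rule mult_mat_vec_carrier[of _ P P]) auto
  have Fv: "?F *\<^sub>v v = unit_vec P k"
    unfolding v_def by (subst assoc_mult_mat_vec[symmetric, of _ P P _ P]) (auto simp: dft_idft)
  have "v \<noteq> 0\<^sub>v P"
  proof
    assume "v = 0\<^sub>v P"
    then have "(?F *\<^sub>v v) $ k = 0"
      using assms by simp
    with assms show False unfolding Fv by simp
  qed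
  moreover have "circ_of_spectrum P f *\<^sub>v v = f k \<cdot>\<^sub>v v"
  proof -
    have "circ_of_spectrum P f *\<^sub>v v = ?B * mat_diag P f *\<^sub>v unit_vec P k"
      unfolding circ_of_spectrum_conv[symmetric] Fv[symmetric]
      by (rule assoc_mult_mat_vec[of _ P P _ P]) (use v in \<open>auto intro!: mult_carrier_mat[of _ P P _ P]\<close>)
    also have "\<dots> = ?B *\<^sub>v (mat_diag P f *\<^sub>v unit_vec P k)"
      by (rule assoc_mult_mat_vec[of _ P P _ P]) auto
    also have "mat_diag P f *\<^sub>v unit_vec P k = f k \<cdot>\<^sub>v unit_vec P k"
      using assms by (intro eq_vecI) (auto simp: mat_diag_def)
    also have "?B *\<^sub>v (f k \<cdot>\<^sub>v unit_vec P k) = f k \<cdot>\<^sub>v v"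
      unfolding v_def by (rule mult_mat_vec[of _ P P]) auto
    finally show ?thesis .
  qed
  ultimately show ?thesis
    using v by (auto simp: eigenvalue_def eigenvector_def)
qed

section \<open>Singular values and the first column\<close>

lemma finite_singular_values:
  assumes "A \<in> carrier_mat m n"
  shows "finite (singular_values A)"
proof -
  have "mat_adjoint A * A \<in> carrier_mat n n"
    using assms by (intro carrier_matI) auto
  then have "finite (spectrum (mat_adjoint A * A))"
    by (rule card_finite_spectrum)
  \<comment> \<open>Squaring maps singular values into a finite spectrum, injectively because they
    are nonnegative.\<close>
  moreover have "(\<lambda>s. complex_of_real (s\<^sup>2)) ` singular_values A \<subseteq> spectrum (mat_adjoint A * A)"
    by (auto simp: singular_values_def spectrum_def)
  moreover have "inj_on (\<lambda>s. complex_of_real (s\<^sup>2)) (singular_values A)"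
    unfolding inj_on_def of_real_eq_iff by (auto simp: singular_values_def)
  ultimately show ?thesis
    by (meson finite_imageD finite_subset)
qed

text \<open>The Gram matrix has eigenvalue \<open>(cmod (f k))\<^sup>2\<close>, so
  \<open>cmod (f k)\<close> is itself a singular value; finiteness lets \<open>Max\<close> bound
  it.\<close>

lemma cmod_spectrum_le_sigma1:
  assumes "k < P"
  shows "cmod (f k) \<le> sigma1 (circ_of_spectrum P f)"
proof -
  have "cmod (f k) \<in> singular_values (circ_of_spectrum P f)"
    using circ_of_spectrum_eigenvalue[OF assms, of "\<lambda>k. of_real ((cmod (f k))\<^sup>2)"]
    by (simp add: singular_values_def circ_of_spectrum_gram)
  then show ?thesis
    unfolding sigma1_def by (intro Max_ge finite_singular_values) auto
qed

text \<open>Parseval's identity: both sides are the \<open>(0, 0)\<close> entry of the Gram matrix,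
  where all phases are 1.\<close>

lemma sum_first_column_square:
  assumes "P \<ge> 1"
  shows "(\<Sum>i<P. (cmod (circ_of_spectrum P f $$ (i, 0)))\<^sup>2) = (\<Sum>k<P. (cmod (f k))\<^sup>2) / real P"
proof -
  let ?C = "circ_of_spectrum P f"
  have "complex_of_real (\<Sum>i<P. (cmod (?C $$ (i, 0)))\<^sup>2) = (\<Sum>i<P. cnj (?C $$ (i, 0)) * ?C $$ (i, 0))"
    unfolding of_real_sum complex_norm_square by (simp add: mult.commute)
  also have "\<dots> = (mat_adjoint ?C * ?C) $$ (0, 0)"
    using assms by (simp add: scalar_prod_def mat_adjoint_index atLeast0LessThan)
  also have "\<dots> = complex_of_real ((\<Sum>k<P. (cmod (f k))\<^sup>2) / real P)"
    using assms unfolding circ_of_spectrum_gram by (simp add: circ_of_spectrum_def)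
  finally show ?thesis
    unfolding of_real_eq_iff .
qed

lemma first_column_norm1_le:
  assumes "P \<ge> 1"
  shows "norm1_vec (col (circ_of_spectrum P f) 0) \<le> sqrt (real P) * sigma1 (circ_of_spectrum P f)"
proof -
  let ?C = "circ_of_spectrum P f"
  have nonneg: "0 \<le> sigma1 ?C"
    using cmod_spectrum_le_sigma1[of 0 P f] assms norm_ge_zero[of "f 0"] by linarith
  have "(norm1_vec (col ?C 0))\<^sup>2 = (\<Sum>i<P. cmod (?C $$ (i, 0)))\<^sup>2"
    using assms by (simp add: norm1_vec_def)
  \<comment> \<open>Cauchy--Schwarz; its factor \<open>P\<close> cancels the \<open>1 / P\<close> of
    Parseval's identity.\<close>
  also have "\<dots> \<le> real P * (\<Sum>i<P. (cmod (?C $$ (i, 0)))\<^sup>2)"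
    using sum_squared_le_sum_of_squares[of "\<lambda>i. cmod (?C $$ (i, 0))" "{..<P}"] by (simp add: mult.commute)
  also have "\<dots> = (\<Sum>k<P. (cmod (f k))\<^sup>2)"
    using assms by (simp add: sum_first_column_square)
  also have "\<dots> \<le> (\<Sum>k<P. (sigma1 ?C)\<^sup>2)"
    by (intro sum_mono power_mono cmod_spectrum_le_sigma1) auto
  also have "\<dots> = (sqrt (real P) * sigma1 ?C)\<^sup>2"
    by (simp add: power_mult_distrib)
  finally show ?thesis
    by (rule power2_le_imp_le) (use nonneg in simp)
qed

section \<open>Rows as permutations of the first column\<close>

definition cyc_diff :: "nat \<Rightarrow> nat \<Rightarrow> nat \<Rightarrow> nat" where
  "cyc_diff P i j = (if j \<le> i then i - j else i + P - j)"

lemma circ_of_spectrum_shift: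
  assumes "i < P" "j < P"
  shows "circ_of_spectrum P f $$ (i, j) = circ_of_spectrum P f $$ (cyc_diff P i j, 0)"
proof -
  have lt: "cyc_diff P i j < P" using assms by (auto simp: cyc_diff_def)
  have "cis (2 * pi * real k * (real i - real j) / real P) =
      cis (2 * pi * real k * real (cyc_diff P i j) / real P)" for k
  proof (cases "j \<le> i")
    case True
    then show ?thesis by (simp add: cyc_diff_def of_nat_diff)
  next
    case False
    \<comment> \<open>Wrapping around adds \<open>P\<close> to \<open>i - j\<close>, hence
      \<open>k\<close> full turns to the phase.\<close>
    then have "2 * pi * real k * real (cyc_diff P i j) / real P =
        2 * pi * real k * (real i - real j) / real P + 2 * pi * real k"
      using assms by (simp add: cyc_diff_def of_nat_diff field_simps)
    moreover have "cis (2 * pi * real k) = 1"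
      by (rule cis_multiple_2pi) simp
    ultimately show ?thesis by (simp flip: cis_mult)
  qed
  then show ?thesis using assms lt by (simp add: circ_of_spectrum_def)
qed

lemma row_norm1_eq_first_column:
  assumes "i < P"
  shows "(\<Sum>j<P. cmod (circ_of_spectrum P f $$ (i, j))) = norm1_vec (col (circ_of_spectrum P f) 0)"
proof -
  have "(\<Sum>j<P. cmod (circ_of_spectrum P f $$ (i, j))) =
      (\<Sum>m<P. cmod (circ_of_spectrum P f $$ (m, 0)))"
    \<comment> \<open>For fixed \<open>i\<close>, the map \<open>cyc_diff P i\<close> is an
      involution of the indices below \<open>P\<close>, so it serves as its own inverse.\<close>
    by (rule sum.reindex_bij_witness[of _ "cyc_diff P i" "cyc_diff P i"])
      (use assms in \<open>auto simp: circ_of_spectrum_shift, auto simp: cyc_diff_def split: if_splits\<close>)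
  also have "\<dots> = norm1_vec (col (circ_of_spectrum P f) 0)"
    using assms by (simp add: norm1_vec_def)
  finally show ?thesis .
qed

lemma circ_mult_vec_norm_le:
  assumes "i < P" "x \<in> carrier_vec P" and bound: "\<And>j. j < P \<Longrightarrow> cmod (x $ j) \<le> b"
  shows "cmod ((circ_of_spectrum P f *\<^sub>v x) $ i) \<le> norm1_vec (col (circ_of_spectrum P f) 0) * b"
proof -
  let ?C = "circ_of_spectrum P f"
  have "(?C *\<^sub>v x) $ i = (\<Sum>j<P. ?C $$ (i, j) * x $ j)"
    using assms(1,2) by (simp add: scalar_prod_def atLeast0LessThan)
  also have "cmod \<dots> \<le> (\<Sum>j<P. cmod (?C $$ (i, j)) * b)"
    by (rule sum_norm_le) (auto simp: norm_mult intro!: mult_left_mono bound)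
  also have "\<dots> = norm1_vec (col ?C 0) * b"
    using row_norm1_eq_first_column[OF assms(1), of f] by (simp flip: sum_distrib_right)
  finally show ?thesis .
qed

section \<open>Application to the transfer function and the fixed point\<close>

lemma H_circ_conv:
  "H_circ num den P = circ_of_spectrum P
     (\<lambda>k. rational_eval num den (exp (- (2 * of_real pi * \<i> * of_nat k / of_nat P))))"
  by (simp add: H_circ_def transfer_diag_def mat_inverse_dft circ_of_spectrum_conv)

text \<open>The all-ones vector is column 0 of the DFT matrix, so associativity moves it into the
  product defining \<open>H_circ\<close>.\<close>

lemma g_bar_conv:
  assumes "P \<ge> 1"
  shows "g_bar num den P = col (H_circ num den P) 0"
proof -
  let ?F = "dft_mat P" and ?B = "idft_mat P" and ?L = "transfer_diag num den P"
  have L: "?L \<in> carrier_mat P P" by (simp add: transfer_diag_def)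
  have ones: "vec P (\<lambda>_. 1) = col ?F 0"
    using assms by (intro eq_vecI) (auto simp: dft_mat_def)
  have "g_bar num den P = ?B * ?L *\<^sub>v col ?F 0"
    unfolding g_bar_def mat_inverse_dft option.sel ones
    by (rule assoc_mult_mat_vec[of _ P P _ P, symmetric]) (use L assms in \<open>auto simp: dft_mat_def\<close>)
  also have "\<dots> = col (?B * ?L * ?F) 0"
    by (rule col_mult2[of _ P P _ P, symmetric]) (use L assms in auto)
  finally show ?thesis
    by (simp add: H_circ_def mat_inverse_dft)
qed

theorem theorem2:
  fixes P :: nat
    and g :: "nat \<Rightarrow> real"
    and num den :: "real poly"
    and \<psi> :: "real \<Rightarrow> real"
    and u :: "real vec"
  assumes "P \<ge> 1"
    and "lti_system g num den"
    and "no_pole_at_roots_of_unity den P"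
    and "bdd_above (range (\<lambda>x. \<bar>\<psi> x\<bar>))"
    and "nontrivial_fixed_point num den P \<psi> u"
  shows "norm_inf_vec u \<le> norm1_vec (g_bar num den P) * (SUP x. \<bar>\<psi> x\<bar>)
    \<and> norm_inf_vec u \<le> sqrt (real P) * sigma1 (H_circ num den P) * (SUP x. \<bar>\<psi> x\<bar>)"
proof -
  let ?b = "SUP x. \<bar>\<psi> x\<bar>" and ?H = "H_circ num den P"
  let ?x = "map_vec complex_of_real (map_vec \<psi> u)"
  obtain f where H: "?H = circ_of_spectrum P f"
    using H_circ_conv by blast
  have u: "u \<in> carrier_vec P" "map_vec complex_of_real u = - (?H *\<^sub>v ?x)"
    using assms(5) by (auto simp: nontrivial_fixed_point_def)
  have psi: "\<bar>\<psi> x\<bar> \<le> ?b" for x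
    using assms(4) by (intro cSUP_upper) auto
  have b: "0 \<le> ?b"
    using psi[of 0] by linarith
  have entry: "\<bar>u $ i\<bar> \<le> norm1_vec (g_bar num den P) * ?b" if "i < P" for i
  proof -
    \<comment> \<open>The fixed-point equation is complex; taking moduli removes both the sign and
      the embedding of the reals.\<close>
    have "complex_of_real (u $ i) = - ((?H *\<^sub>v ?x) $ i)"
      using arg_cong[OF u(2), of "\<lambda>v. v $ i"] u(1) that by (simp add: H)
    then have "\<bar>u $ i\<bar> = cmod ((?H *\<^sub>v ?x) $ i)"
      by (metis norm_minus_cancel norm_of_real)
    also have "\<dots> \<le> norm1_vec (g_bar num den P) * ?b"
      unfolding g_bar_conv[OF assms(1)] H
      by (rule circ_mult_vec_norm_le[OF that]) (use u(1) psi in auto)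
    finally show ?thesis .
  qed
  have first: "norm_inf_vec u \<le> norm1_vec (g_bar num den P) * ?b"
    \<comment> \<open>\<open>P \<ge> 1\<close> makes the set under \<open>Max\<close> nonempty, so
      the entrywise bound passes to the maximum.\<close>
    unfolding norm_inf_vec_def using u(1) assms(1) entry by (subst Max_le_iff) (auto simp: lessThan_empty_iff)
  also have "\<dots> \<le> sqrt (real P) * sigma1 ?H * ?b"
    using first_column_norm1_le[OF assms(1), of f] b
    by (intro mult_right_mono) (simp_all add: g_bar_conv[OF assms(1)] H)
  finally show ?thesis
    using first by blast
qed

end
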